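(* Let $S$ be a spacelike connected regular surface in the Minkowski space $\mathbb{L}^3$ satisfying the $\mathcal{P}^*$ property, i.e. such that for each spacelike affine plane $\Pi\subset\mathbb{L}^3$ with $\Pi\cap S\neq\emptyset$, the set $\Pi\cap S$ is a circle in $\Pi$ (possibly degenerate, of radius zero). Then $S$ is a hyperbolic plane, i.e. there exist $c\in\mathbb{L}^3$ and $r>0$ such that $S$ is one of the two connected components of the two-sheeted hyperboloid $\{x\in\mathbb{L}^3 : \langle x-c,x-c\rangle=-r^2\}$.
   Context: $\mathbb{L}^3$ is $\mathbb{R}^3$ with the Lorentzian inner product $\langle x,y\rangle=x_1y_1+x_2y_2-x_3y_3$. A regular surface is a nonempty smooth embedded $2$-dimensional submanifold of $\mathbb{R}^3$ (without boundary) in the usual sense; it is not assumed to be complete or closed as a subset. It is spacelike if the metric induced on it by $\langle\cdot,\cdot\rangle$ is Riemannian, i.e. $\langle\cdot,\cdot\rangle$ restricted to each tangent plane is positive definite. An affine plane is spacelike if $\langle\cdot,\cdot\rangle$ restricted to its direction plane is positive definite. A circle in a spacelike affine plane $\Pi$ is the locus of points of $\Pi$ at a constant distance from a fixed point of $\Pi$, for the distance associated to the induced metric: $\{x\in\Pi : \langle x-p,x-p\rangle=\rho^2\}$ with $p\in\Pi$ and $\rho\ge 0$; the degenerate case $\rho=0$ is a single point. *)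

theory Defs
  imports "HOL-Analysis.Analysis"
begin

definition lorentz :: "real^3 \<Rightarrow> real^3 \<Rightarrow> real" where
  "lorentz x y = x $ 1 * y $ 1 + x $ 2 * y $ 2 - x $ 3 * y $ 3"

(* Positive definiteness of the restriction of the product to a set of vectors,
   which in all uses is a linear subspace. *)
definition spacelike_subspace :: "(real^3) set \<Rightarrow> bool" where
  "spacelike_subspace W \<longleftrightarrow> (\<forall>w\<in>W. w \<noteq> 0 \<longrightarrow> lorentz w w > 0)"

(* Only meaningful for open U: the derivatives are taken in the ambient space. *)
primrec C_k_on :: "nat \<Rightarrow> ('a::real_normed_vector \<Rightarrow> 'b::real_normed_vector) \<Rightarrow> 'a set \<Rightarrow> bool" where
  "C_k_on 0 f U \<longleftrightarrow> continuous_on U f"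
| "C_k_on (Suc k) f U \<longleftrightarrow>
     (\<forall>x\<in>U. f differentiable (at x)) \<and>
     (\<forall>v. C_k_on k (\<lambda>x. frechet_derivative f (at x) v) U)"

definition smooth_on :: "('a::real_normed_vector \<Rightarrow> 'b::real_normed_vector) \<Rightarrow> 'a set \<Rightarrow> bool" where
  "smooth_on f U \<longleftrightarrow> (\<forall>k. C_k_on k f U)"

(* A smooth immersion of U that is a homeomorphism onto the relatively open
   subset V \<inter> S of S. *)
definition local_parametrization ::
    "(real^3) set \<Rightarrow> (real^2) set \<Rightarrow> (real^3) set \<Rightarrow> (real^2 \<Rightarrow> real^3) \<Rightarrow> bool" where
  "local_parametrization S U V \<phi> \<longleftrightarrow>
     open U \<and> open V \<and> smooth_on \<phi> U \<and>
     (\<exists>\<psi>. homeomorphism U (V \<inter> S) \<phi> \<psi>) \<and>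
     (\<forall>q\<in>U. inj (frechet_derivative \<phi> (at q)))"

definition regular_surface :: "(real^3) set \<Rightarrow> bool" where
  "regular_surface S \<longleftrightarrow>
     S \<noteq> {} \<and> (\<forall>p\<in>S. \<exists>U V \<phi>. p \<in> V \<and> local_parametrization S U V \<phi>)"

definition tangent_plane :: "(real^3) set \<Rightarrow> real^3 \<Rightarrow> (real^3) set" where
  "tangent_plane S p =
     {w. \<exists>\<epsilon>>0. \<exists>\<alpha> :: real \<Rightarrow> real^3.
           smooth_on \<alpha> {-\<epsilon><..<\<epsilon>} \<and> \<alpha> ` {-\<epsilon><..<\<epsilon>} \<subseteq> S \<and> \<alpha> 0 = p \<and>
           (\<alpha> has_vector_derivative w) (at 0)}"

definition spacelike_surface :: "(real^3) set \<Rightarrow> bool" where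
  "spacelike_surface S \<longleftrightarrow>
     regular_surface S \<and> (\<forall>p\<in>S. spacelike_subspace (tangent_plane S p))"

definition affine_plane :: "(real^3) set \<Rightarrow> bool" where
  "affine_plane P \<longleftrightarrow> affine P \<and> aff_dim P = 2"

definition spacelike_plane :: "(real^3) set \<Rightarrow> bool" where
  "spacelike_plane P \<longleftrightarrow> affine_plane P \<and> spacelike_subspace {x - y | x y. x \<in> P \<and> y \<in> P}"

definition circle_in :: "(real^3) set \<Rightarrow> (real^3) set \<Rightarrow> bool" where
  "circle_in P C \<longleftrightarrow>
     (\<exists>p\<in>P. \<exists>\<rho>\<ge>0. C = {x \<in> P. lorentz (x - p) (x - p) = \<rho>\<^sup>2})"

definition P_star :: "(real^3) set \<Rightarrow> bool" where
  "P_star S \<longleftrightarrow> (\<forall>P. spacelike_plane P \<and> P \<inter> S \<noteq> {} \<longrightarrow> circle_in P (P \<inter> S))"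

definition two_sheeted_hyperboloid :: "real^3 \<Rightarrow> real \<Rightarrow> (real^3) set" where
  "two_sheeted_hyperboloid c r = {x. lorentz (x - c) (x - c) = - r\<^sup>2}"

definition hyperbolic_plane :: "(real^3) set \<Rightarrow> bool" where
  "hyperbolic_plane S \<longleftrightarrow> (\<exists>c r. r > 0 \<and> S \<in> components (two_sheeted_hyperboloid c r))"

end

theory Submission
  imports Defs
begin

text \<open>
  Fix \<open>p\<close> in \<open>S\<close>. A spacelike plane through \<open>p\<close> with direction \<open>W\<close> cuts \<open>S\<close> in a circle through \<open>p\<close>,
  that is, in the set of all \<open>p + w\<close> with \<open>w\<close> in \<open>W\<close> and \<open>\<langle>w, w\<rangle> = \<lambda>\<^sub>W w\<close> for a linear form
  \<open>\<lambda>\<^sub>W\<close>. Two such planes meet in a line, on which the second intersection point with \<open>S\<close> determines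
  the form, so the \<open>\<lambda>\<^sub>W\<close> agree on overlaps and glue to one linear form \<open>2\<langle>c, w\<rangle>\<close> on \<open>\<real>\<^sup>3\<close>: for
  spacelike \<open>w\<close>, the point \<open>p + w\<close> lies in \<open>S\<close> iff \<open>\<langle>w, w\<rangle> = 2\<langle>c, w\<rangle>\<close>. Near \<open>p\<close> all points of \<open>S\<close>
  are spacelike separated from \<open>p\<close>, so the tangent plane at \<open>p\<close> is orthogonal to \<open>c\<close>, and \<open>c\<close> is
  timelike. On the hyperboloid around \<open>p + c\<close> through \<open>p\<close>, the points spacelike separated from \<open>p\<close>
  are exactly the other points of the sheet of \<open>p\<close>. This sheet is therefore contained in \<open>S\<close>, open
  and closed in \<open>S\<close>, and hence equal to \<open>S\<close>.
\<close>

section \<open>Algebra and continuity of the Lorentzian product\<close>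

lemma lorentz_simps:
  "lorentz (x + y) z = lorentz x z + lorentz y z"
  "lorentz (x - y) z = lorentz x z - lorentz y z"
  "lorentz z (x + y) = lorentz z x + lorentz z y"
  "lorentz z (x - y) = lorentz z x - lorentz z y"
  "lorentz (t *\<^sub>R x) z = t * lorentz x z"
  "lorentz z (t *\<^sub>R x) = t * lorentz z x"
  by (auto simp: lorentz_def algebra_simps)

lemma continuous_on_lorentz [continuous_intros]:
  "continuous_on A f \<Longrightarrow> continuous_on A g \<Longrightarrow> continuous_on A (\<lambda>x. lorentz (f x) (g x))"
  unfolding lorentz_def by (intro continuous_intros)

lemma open_spacelike: "open {x. lorentz (x - p) (x - p) > 0}"
  by (intro open_Collect_less continuous_intros)

lemma vec3_eq_iff: "(x :: real^3) = y \<longleftrightarrow> x$1 = y$1 \<and> x$2 = y$2 \<and> x$3 = y$3"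
  by (simp add: vec_eq_iff forall_3)

section \<open>Smooth curves in charts and tangent vectors\<close>

text \<open>On an open set the two functions agree near each point, so their derivatives agree there
  too. This lets a derivative be replaced by a formula known only on the set.\<close>

lemma C_k_on_cong:
  assumes "open U" "\<And>x. x \<in> U \<Longrightarrow> f x = g x" "C_k_on k f U"
  shows "C_k_on k g U"
  using assms(2,3)
proof (induction k arbitrary: f g)
  case 0
  then show ?case by (metis C_k_on.simps(1) continuous_on_cong)
next
  case (Suc k)
  have der: "(g has_derivative frechet_derivative f (at x)) (at x)" if "x \<in> U" for x
    using Suc.prems that assms(1)
    by (metis C_k_on.simps(2) frechet_derivative_works has_derivative_transform_within_open)
  have "frechet_derivative f (at x) v = frechet_derivative g (at x) v" if "x \<in> U" for x v
    using frechet_derivative_at[OF der[OF that]] by simp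
  then have "C_k_on k (\<lambda>x. frechet_derivative g (at x) v) U" for v
    using Suc.IH[of "\<lambda>x. frechet_derivative f (at x) v" "\<lambda>x. frechet_derivative g (at x) v"]
      Suc.prems by simp
  with der show ?case by (auto simp: differentiable_def)
qed

text \<open>By the chain rule the derivative along the line is again a directional derivative of
  \<open>f\<close> restricted to that line, so induction on \<open>k\<close> applies with
  \<open>f\<close> arbitrary.\<close>

lemma C_k_on_line:
  assumes "open I" "\<And>t. t \<in> I \<Longrightarrow> q + t *\<^sub>R h \<in> U" "C_k_on k f U"
  shows "C_k_on k (\<lambda>t. f (q + t *\<^sub>R h)) I"
  using assms(3)
proof (induction k arbitrary: f)
  case 0
  then show ?case
    using assms(2)
    by (auto intro!: continuous_on_compose2[of U f] continuous_intros)
next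
  case (Suc k)
  have der: "((\<lambda>t. f (q + t *\<^sub>R h)) has_derivative
      (\<lambda>v. frechet_derivative f (at (q + t *\<^sub>R h)) (v *\<^sub>R h))) (at t)" if "t \<in> I" for t
  proof -
    have "(f has_derivative frechet_derivative f (at (q + t *\<^sub>R h))) (at (q + t *\<^sub>R h))"
      using Suc.prems assms(2)[OF that] by (simp add: frechet_derivative_works)
    moreover have "((\<lambda>t. q + t *\<^sub>R h) has_derivative (\<lambda>v. v *\<^sub>R h)) (at t)"
      by (auto intro!: derivative_eq_intros)
    ultimately show ?thesis
      by (rule has_derivative_compose[rotated])
  qed
  have "C_k_on k (\<lambda>t. frechet_derivative (\<lambda>t. f (q + t *\<^sub>R h)) (at t) v) I" for v
  proof (rule C_k_on_cong[OF assms(1)])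
    show "C_k_on k (\<lambda>t. frechet_derivative f (at (q + t *\<^sub>R h)) (v *\<^sub>R h)) I"
      using Suc.IH[of "\<lambda>x. frechet_derivative f (at x) (v *\<^sub>R h)"] Suc.prems by simp
    show "frechet_derivative f (at (q + t *\<^sub>R h)) (v *\<^sub>R h) =
        frechet_derivative (\<lambda>t. f (q + t *\<^sub>R h)) (at t) v" if "t \<in> I" for t
      using frechet_derivative_at[OF der[OF that]] by metis
  qed
  with der show ?case by (auto simp: differentiable_def)
qed

lemma local_parametrization_derivative:
  assumes "local_parametrization S U V \<phi>" "q \<in> U"
  shows "(\<phi> has_derivative frechet_derivative \<phi> (at q)) (at q)"
proof -
  have "C_k_on 1 \<phi> U"
    using assms unfolding local_parametrization_def smooth_on_def by blast
  then show ?thesis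
    using assms by (simp add: frechet_derivative_works)
qed

text \<open>The witnessing curve is the image under the chart of the segment through
  \<open>q\<close> in direction \<open>h\<close>.\<close>

lemma derivative_in_tangent_plane:
  assumes "local_parametrization S U V \<phi>" "q \<in> U"
  shows "frechet_derivative \<phi> (at q) h \<in> tangent_plane S (\<phi> q)"
proof -
  obtain \<psi> where U: "open U" "smooth_on \<phi> U" and hom: "homeomorphism U (V \<inter> S) \<phi> \<psi>"
    using assms by (auto simp: local_parametrization_def)
  have "open ((\<lambda>t::real. q + t *\<^sub>R h) -` U)"
    using U by (intro open_vimage continuous_intros)
  moreover have "0 \<in> (\<lambda>t::real. q + t *\<^sub>R h) -` U"
    using assms by simp
  ultimately obtain e where e: "e > 0" "ball 0 e \<subseteq> (\<lambda>t::real. q + t *\<^sub>R h) -` U"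
    using open_contains_ball by blast
  then have in_U: "q + t *\<^sub>R h \<in> U" if "t \<in> {-e<..<e}" for t
    using that by (auto simp: subset_iff dist_real_def)
  have line: "((\<lambda>t. q + t *\<^sub>R h) has_derivative (\<lambda>v. v *\<^sub>R h)) (at 0)"
    by (auto intro!: derivative_eq_intros)
  have "((\<lambda>t. \<phi> (q + t *\<^sub>R h)) has_derivative
      (\<lambda>v. frechet_derivative \<phi> (at q) (v *\<^sub>R h))) (at 0)"
    using has_derivative_compose[OF line, of \<phi> "frechet_derivative \<phi> (at q)"]
      local_parametrization_derivative[OF assms] by simp
  moreover have "linear (frechet_derivative \<phi> (at q))"
    using local_parametrization_derivative[OF assms] has_derivative_linear by blast
  ultimately have "((\<lambda>t. \<phi> (q + t *\<^sub>R h)) has_vector_derivative frechet_derivative \<phi> (at q) h) (at 0)"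
    by (simp add: has_vector_derivative_def linear_scale)
  moreover have "smooth_on (\<lambda>t. \<phi> (q + t *\<^sub>R h)) {-e<..<e}"
    using U in_U unfolding smooth_on_def by (auto intro!: C_k_on_line[of _ _ _ U])
  moreover have "(\<lambda>t. \<phi> (q + t *\<^sub>R h)) ` {-e<..<e} \<subseteq> S"
    using in_U hom by (auto simp: homeomorphism_def)
  ultimately show ?thesis
    using e(1) unfolding tangent_plane_def mem_Collect_eq
    by (intro exI[of _ e] conjI exI[of _ "\<lambda>t. \<phi> (q + t *\<^sub>R h)"]) auto
qed

section \<open>Local spacelike separation on the surface\<close>

text \<open>The differential sends the unit circle to a compact set of spacelike vectors, which has
  an \<open>e\<close>-neighbourhood of spacelike vectors. By differentiability, chords from
  \<open>p\<close> divided by the parameter distance fall into that neighbourhood.\<close>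

lemma spacelike_surface_locally_spacelike:
  assumes "spacelike_surface S" "p \<in> S"
  obtains V where "open V" "p \<in> V" "\<And>x. x \<in> S \<inter> V \<Longrightarrow> x \<noteq> p \<Longrightarrow> lorentz (x - p) (x - p) > 0"
proof -
  obtain U V \<phi> where pV: "p \<in> V" and lp: "local_parametrization S U V \<phi>"
    using assms unfolding spacelike_surface_def regular_surface_def by blast
  then obtain \<psi> where U: "open U" "open V" and hom: "homeomorphism U (V \<inter> S) \<phi> \<psi>"
    by (auto simp: local_parametrization_def)
  define q where "q = \<psi> p"
  have q: "q \<in> U" "\<phi> q = p"
    using hom pV assms by (auto simp: homeomorphism_def q_def)
  define L where "L = frechet_derivative \<phi> (at q)"
  have L: "(\<phi> has_derivative L) (at q)"
    using local_parametrization_derivative[OF lp q(1)] by (simp add: L_def)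
  then interpret L: bounded_linear L by (rule has_derivative_bounded_linear)
  have "inj L" using lp q by (auto simp: local_parametrization_def L_def)
  have "lorentz (L h) (L h) > 0" if "h \<noteq> 0" for h
  proof -
    have "L h \<in> tangent_plane S p"
      using derivative_in_tangent_plane[OF lp q(1)] q L_def by simp
    moreover have "L h \<noteq> 0"
      using that \<open>inj L\<close> L.zero by (metis injD)
    ultimately show ?thesis
      using assms unfolding spacelike_surface_def spacelike_subspace_def by blast
  qed
  moreover have "h \<noteq> 0" if "h \<in> sphere 0 1" for h :: "real^2"
    using that by auto
  ultimately have sub: "L ` sphere 0 1 \<subseteq> {w. lorentz w w > 0}"
    by blast
  have "compact (L ` sphere 0 1)"
    by (intro compact_continuous_image L.continuous_on continuous_intros compact_sphere)
  with sub obtain e where e: "e > 0" "(\<Union>x\<in>L ` sphere 0 1. ball x e) \<subseteq> {w. lorentz w w > 0}"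
    using compact_subset_open_imp_ball_epsilon_subset[of "L ` sphere 0 1" "{w. lorentz w w > 0}"]
      open_spacelike[of 0] by (auto simp: subset_iff)
  obtain d where d: "d > 0" "\<And>y. norm (y - q) < d \<Longrightarrow>
      norm (\<phi> y - \<phi> q - L (y - q)) \<le> e / 2 * norm (y - q)"
    using L e(1) unfolding has_derivative_at_alt by (meson half_gt_zero)
  have pos: "lorentz (\<phi> y - p) (\<phi> y - p) > 0" if y: "norm (y - q) < d" "y \<noteq> q" for y
  proof -
    define n where "n = norm (y - q)"
    have n: "n > 0" using y by (simp add: n_def)
    define w where "w = (\<phi> y - p) /\<^sub>R n"
    have "n *\<^sub>R (w - L ((y - q) /\<^sub>R n)) = \<phi> y - \<phi> q - L (y - q)"
      using n unfolding w_def L.scaleR q by (simp add: scaleR_right_diff_distrib)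
    then have "n * norm (w - L ((y - q) /\<^sub>R n)) \<le> n * (e / 2)"
      using d(2)[OF y(1)] n by (metis n_def abs_of_pos mult.commute norm_scaleR)
    then have "norm (w - L ((y - q) /\<^sub>R n)) \<le> e / 2"
      using n by simp
    then have "w \<in> ball (L ((y - q) /\<^sub>R n)) e"
      using e(1) by (simp add: dist_norm norm_minus_commute)
    moreover have "(y - q) /\<^sub>R n \<in> sphere 0 1"
      using n by (simp add: n_def)
    ultimately have "lorentz w w > 0" using e(2) by blast
    moreover have "\<phi> y - p = n *\<^sub>R w" using n by (simp add: w_def)
    ultimately show ?thesis using n by (simp add: lorentz_simps)
  qed
  \<comment> \<open>Continuity of the inverse chart ensures that all points of \<open>S\<close> near
    \<open>p\<close> have parameters near \<open>q\<close>.\<close>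
  have "openin (top_of_set (V \<inter> S)) (V \<inter> S \<inter> \<psi> -` ball q d)"
    using hom by (intro continuous_openin_preimage_gen) (auto simp: homeomorphism_def)
  then obtain W where W: "open W" "V \<inter> S \<inter> \<psi> -` ball q d = V \<inter> S \<inter> W"
    by (auto simp: openin_open)
  show ?thesis
  proof (rule that[of "W \<inter> V"])
    show "open (W \<inter> V)" using W U by blast
    have "p \<in> V \<inter> S \<inter> \<psi> -` ball q d" using pV assms d by (simp add: q_def)
    then show "p \<in> W \<inter> V" using W by blast
    fix x assume x: "x \<in> S \<inter> (W \<inter> V)" "x \<noteq> p"
    then have "\<psi> x \<in> ball q d" using W by blast
    moreover have "\<phi> (\<psi> x) = x" using hom x by (auto simp: homeomorphism_def)
    ultimately show "lorentz (x - p) (x - p) > 0"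
      using pos[of "\<psi> x"] x q by (metis dist_commute dist_norm mem_ball)
  qed
qed

section \<open>Plane sections through a point and their gluing\<close>

text \<open>Subtracting the circle equation at \<open>p\<close> from the one at \<open>x\<close>
  eliminates the radius and leaves a term linear in \<open>x - p\<close>. On a plane of slope
  \<open>(a, b)\<close> the third coordinate can be eliminated; the plane is spacelike because the
  slope is below 1.\<close>

lemma section_equation:
  assumes "P_star S" "p \<in> S" "a\<^sup>2 + b\<^sup>2 < 1"
  obtains A B where "\<And>x. x$3 - p$3 = a * (x$1 - p$1) + b * (x$2 - p$2) \<Longrightarrow>
     x \<in> S \<longleftrightarrow> lorentz (x - p) (x - p) = A * (x$1 - p$1) + B * (x$2 - p$2)"
proof -
  define n :: "real^3" where "n = vector [a, b, -1]"
  define P where "P = {x. n \<bullet> x = n \<bullet> p}"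
  have P_iff: "x \<in> P \<longleftrightarrow> x$3 - p$3 = a * (x$1 - p$1) + b * (x$2 - p$2)" for x
    by (auto simp: P_def n_def inner_vec_def sum_3 vector_3 algebra_simps)
  have "n \<noteq> 0" by (auto simp: n_def vec3_eq_iff vector_3)
  then have "affine_plane P"
    by (simp add: affine_plane_def P_def affine_hyperplane aff_dim_hyperplane)
  moreover have "spacelike_subspace {x - y | x y. x \<in> P \<and> y \<in> P}"
    unfolding spacelike_subspace_def
  proof (intro ballI impI)
    fix w assume "w \<in> {x - y | x y. x \<in> P \<and> y \<in> P}" and w0: "w \<noteq> 0"
    then have w3: "w$3 = a * w$1 + b * w$2"
      by (auto simp: P_iff algebra_simps)
    with w0 have "(w$1)\<^sup>2 + (w$2)\<^sup>2 > 0"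
      by (auto simp: vec3_eq_iff sum_power2_gt_zero_iff)
    then have "(a\<^sup>2 + b\<^sup>2) * ((w$1)\<^sup>2 + (w$2)\<^sup>2) < (w$1)\<^sup>2 + (w$2)\<^sup>2"
      using assms(3) by simp
    \<comment> \<open>Cauchy-Schwarz, via Lagrange's identity.\<close>
    moreover have "(a * w$1 + b * w$2)\<^sup>2 \<le> (a\<^sup>2 + b\<^sup>2) * ((w$1)\<^sup>2 + (w$2)\<^sup>2)"
    proof -
      have "(a\<^sup>2 + b\<^sup>2) * ((w$1)\<^sup>2 + (w$2)\<^sup>2) - (a * w$1 + b * w$2)\<^sup>2 = (a * w$2 - b * w$1)\<^sup>2"
        by (simp add: power2_eq_square algebra_simps)
      then show ?thesis using zero_le_power2[of "a * w$2 - b * w$1"] by linarith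
    qed
    ultimately show "lorentz w w > 0"
      using w3 by (simp add: lorentz_def power2_eq_square)
  qed
  moreover have "p \<in> P" by (simp add: P_def)
  ultimately have "circle_in P (P \<inter> S)"
    using assms unfolding P_star_def spacelike_plane_def by blast
  then obtain m \<rho> where m: "P \<inter> S = {x \<in> P. lorentz (x - m) (x - m) = \<rho>\<^sup>2}"
    unfolding circle_in_def by blast
  have eq: "x \<in> S \<longleftrightarrow> lorentz (x - p) (x - p) = 2 * lorentz (x - p) (m - p)" if "x \<in> P" for x
  proof -
    have "x \<in> S \<longleftrightarrow> lorentz (x - m) (x - m) = \<rho>\<^sup>2" using m that by blast
    moreover have "lorentz (p - m) (p - m) = \<rho>\<^sup>2" using m assms \<open>p \<in> P\<close> by blast
    moreover have "lorentz (x - m) (x - m) - lorentz (p - m) (p - m) =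
        lorentz (x - p) (x - p) - 2 * lorentz (x - p) (m - p)"
      by (simp add: lorentz_def algebra_simps)
    ultimately show ?thesis by linarith
  qed
  show ?thesis
  proof (rule that[of "2 * (m$1 - p$1 - a * (m$3 - p$3))" "2 * (m$2 - p$2 - b * (m$3 - p$3))"])
    fix x :: "real^3" assume x: "x$3 - p$3 = a * (x$1 - p$1) + b * (x$2 - p$2)"
    then have "2 * lorentz (x - p) (m - p) = 2 * (m$1 - p$1 - a * (m$3 - p$3)) * (x$1 - p$1)
        + 2 * (m$2 - p$2 - b * (m$3 - p$3)) * (x$2 - p$2)"
      by (simp add: lorentz_def) (simp add: algebra_simps)
    then show "x \<in> S \<longleftrightarrow> lorentz (x - p) (x - p) =
        2 * (m$1 - p$1 - a * (m$3 - p$3)) * (x$1 - p$1)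
        + 2 * (m$2 - p$2 - b * (m$3 - p$3)) * (x$2 - p$2)"
      using eq[of x] x P_iff by simp
  qed
qed

text \<open>
  The plane of slope \<open>(a, b)\<close> through \<open>p\<close> carries the linear form with coefficients \<open>(A a b, B a b)\<close>;
  agreement of two such forms on the common line of their planes says that the difference of the
  coefficients is parallel to the difference of the slopes.
\<close>
lemma difference_parallel_imp_homothety:
  fixes A B :: "real \<Rightarrow> real \<Rightarrow> real"
  assumes par: "\<And>a b a' b'. a\<^sup>2 + b\<^sup>2 < 1 \<Longrightarrow> a'\<^sup>2 + b'\<^sup>2 < 1 \<Longrightarrow>
      (A a b - A a' b') * (b - b') = (B a b - B a' b') * (a - a')"
  obtains k where "\<And>a b. a\<^sup>2 + b\<^sup>2 < 1 \<Longrightarrow> A a b = A 0 0 + k * a \<and> B a b = B 0 0 + k * b"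
proof -
  \<comment> \<open>The slopes \<open>(0, 0)\<close> and \<open>(1/2, 0)\<close> serve as
    references. From a slope with \<open>b\<close> nonzero they lie in independent directions, so
    the two parallelism conditions determine the coefficients.\<close>
  define k where "k = 2 * (A (1/2) 0 - A 0 0)"
  have B1: "B (1/2) 0 = B 0 0"
    using par[of "1/2" 0 0 0] by (simp add: power2_eq_square)
  have off_axis: "A a b = A 0 0 + k * a \<and> B a b = B 0 0 + k * b" if ab: "a\<^sup>2 + b\<^sup>2 < 1" "b \<noteq> 0" for a b
  proof -
    have 1: "(A a b - A 0 0) * b = (B a b - B 0 0) * a"
      using par[of a b 0 0] ab by simp
    have 2: "(A a b - A (1/2) 0) * b = (B a b - B 0 0) * (a - 1/2)"
      using par[of a b "1/2" 0] ab B1 by (simp add: power2_eq_square)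
    have "(A a b - A 0 0) * b - (A a b - A (1/2) 0) * b = k * b / 2"
      by (simp add: k_def algebra_simps)
    then have Bk: "B a b = B 0 0 + k * b"
      unfolding 1 2 by (simp add: algebra_simps)
    with 1 have "(A a b - A 0 0) * b = (k * a) * b" by simp
    with ab Bk show ?thesis by simp
  qed
  show ?thesis
  proof (rule that)
    fix a b :: real assume ab: "a\<^sup>2 + b\<^sup>2 < 1"
    show "A a b = A 0 0 + k * a \<and> B a b = B 0 0 + k * b"
    proof (cases "b = 0")
      case True
      \<comment> \<open>A slope \<open>(a, 0)\<close> is collinear with both references, so the
        already settled slope \<open>(0, 1/2)\<close> is used as well.\<close>
      have half: "A 0 (1/2) = A 0 0" "B 0 (1/2) = B 0 0 + k / 2"
        using off_axis[of 0 "1/2"] by (auto simp: power2_eq_square)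
      have 1: "B a 0 = B 0 0 \<or> a = 0"
        using par[of a 0 0 0] ab True by simp
      have "(A a 0 - A 0 0) * (- 1/2) = (B a 0 - B 0 0 - k / 2) * a"
        using par[of a 0 0 "1/2"] ab True half by (simp add: power2_eq_square)
      with 1 True show ?thesis by auto
    qed (use off_axis ab in blast)
  qed
qed

lemma spacelike_section_equation:
  assumes "P_star S" "p \<in> S"
  obtains c where "\<And>x. lorentz (x - p) (x - p) > 0 \<Longrightarrow>
     x \<in> S \<longleftrightarrow> lorentz (x - p) (x - p) = 2 * lorentz c (x - p)"
proof -
  have "\<forall>a b. \<exists>A B. a\<^sup>2 + b\<^sup>2 < 1 \<longrightarrow> (\<forall>x::real^3. x$3 - p$3 = a * (x$1 - p$1) + b * (x$2 - p$2) \<longrightarrow>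
     (x \<in> S \<longleftrightarrow> lorentz (x - p) (x - p) = A * (x$1 - p$1) + B * (x$2 - p$2)))"
    using section_equation[OF assms] by metis
  then obtain A B where AB: "\<And>a b x. a\<^sup>2 + b\<^sup>2 < 1 \<Longrightarrow>
     x$3 - p$3 = a * (x$1 - p$1) + b * (x$2 - p$2) \<Longrightarrow>
     x \<in> S \<longleftrightarrow> lorentz (x - p) (x - p) = A a b * (x$1 - p$1) + B a b * (x$2 - p$2)"
    by metis
  have par: "(A a b - A a' b') * (b - b') = (B a b - B a' b') * (a - a')"
    if ab: "a\<^sup>2 + b\<^sup>2 < 1" "a'\<^sup>2 + b'\<^sup>2 < 1" for a b a' b'
  proof (cases "a = a' \<and> b = b'")
    case False
    \<comment> \<open>Direction of the common line: the cross product of the normals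
      \<open>(a', b', -1)\<close> and \<open>(a, b, -1)\<close>.\<close>
    define v :: "real^3" where "v = vector [b - b', a' - a, a' * b - a * b']"
    have v: "v$1 = b - b'" "v$2 = a' - a" "v$3 = a * v$1 + b * v$2" "v$3 = a' * v$1 + b' * v$2"
      by (auto simp: v_def vector_3 algebra_simps)
    have vv: "lorentz v v > 0"
    proof -
      have "(v$1)\<^sup>2 + (v$2)\<^sup>2 > 0"
        using False by (auto simp: v(1,2) sum_power2_gt_zero_iff)
      then have "(a\<^sup>2 + b\<^sup>2) * ((v$1)\<^sup>2 + (v$2)\<^sup>2) < (v$1)\<^sup>2 + (v$2)\<^sup>2"
        using ab by simp
      moreover have "(a\<^sup>2 + b\<^sup>2) * ((v$1)\<^sup>2 + (v$2)\<^sup>2) - (v$3)\<^sup>2 = (a * v$2 - b * v$1)\<^sup>2"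
        unfolding v(3) by (simp add: power2_eq_square algebra_simps)
      ultimately have "(v$3)\<^sup>2 < (v$1)\<^sup>2 + (v$2)\<^sup>2"
        using zero_le_power2[of "a * v$2 - b * v$1"] by linarith
      then show ?thesis by (simp add: lorentz_def power2_eq_square)
    qed
    have on_line: "p + t *\<^sub>R v \<in> S \<longleftrightarrow> t * (t * lorentz v v) = t * (A' * v$1 + B' * v$2)"
      if "\<And>x. x$3 - p$3 = \<alpha> * (x$1 - p$1) + \<beta> * (x$2 - p$2) \<Longrightarrow>
        x \<in> S \<longleftrightarrow> lorentz (x - p) (x - p) = A' * (x$1 - p$1) + B' * (x$2 - p$2)"
        "v$3 = \<alpha> * v$1 + \<beta> * v$2" for t \<alpha> \<beta> A' B'
      using that(1)[of "p + t *\<^sub>R v"] that(2) by (simp add: lorentz_simps algebra_simps)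
    define t where "t = (A a b * v$1 + B a b * v$2) / lorentz v v"
    define t' where "t' = (A a' b' * v$1 + B a' b' * v$2) / lorentz v v"
    have root: "s * (s * lorentz v v) = s * D \<longleftrightarrow> s = 0 \<or> s = D / lorentz v v" for s D
      using vv by (simp only: mult_cancel_left) (simp add: field_simps)
    \<comment> \<open>Both planes describe the same points of \<open>S\<close> on the line, so
      \<open>{0, t}\<close> and \<open>{0, t'}\<close> coincide. This forces \<open>t = t'\<close>
      even if the line meets \<open>S\<close> only at \<open>p\<close>.\<close>
    have S1: "p + s *\<^sub>R v \<in> S \<longleftrightarrow> s = 0 \<or> s = t" for s
      using on_line[OF AB[OF ab(1)] v(3), of s] unfolding root t_def .
    have S2: "p + s *\<^sub>R v \<in> S \<longleftrightarrow> s = 0 \<or> s = t'" for s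
      using on_line[OF AB[OF ab(2)] v(4), of s] unfolding root t'_def .
    have "t = t'" using S1[of t] S2[of t] S1[of t'] S2[of t'] by auto
    then have "A a b * v$1 + B a b * v$2 = A a' b' * v$1 + B a' b' * v$2"
      using vv by (simp add: t_def t'_def)
    then show ?thesis unfolding v(1,2) by (simp add: algebra_simps)
  qed auto
  obtain k where k: "\<And>a b. a\<^sup>2 + b\<^sup>2 < 1 \<Longrightarrow> A a b = A 0 0 + k * a \<and> B a b = B 0 0 + k * b"
    using difference_parallel_imp_homothety[OF par] by blast
  \<comment> \<open>On the plane, \<open>k * (a * w$1 + b * w$2)\<close> is \<open>k * w$3\<close>,
    which removes the slope from the form. The minus sign compensates for the sign in
    \<open>lorentz\<close>.\<close>
  define c :: "real^3" where "c = vector [A 0 0 / 2, B 0 0 / 2, - k / 2]"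
  show ?thesis
  proof (rule that[of c])
    fix x assume x: "lorentz (x - p) (x - p) > 0"
    define w where "w = x - p"
    define m where "m = (w$1)\<^sup>2 + (w$2)\<^sup>2"
    \<comment> \<open>The least steep plane containing \<open>w\<close>: its slope vector is
      parallel to the horizontal part of \<open>w\<close> and has squared length
      \<open>(w$3)\<^sup>2 / m\<close>.\<close>
    define a where "a = w$3 * w$1 / m"
    define b where "b = w$3 * w$2 / m"
    have m: "(w$3)\<^sup>2 < m"
      using x by (simp add: m_def lorentz_def w_def power2_eq_square)
    then have m0: "m > 0" using zero_le_power2[of "w$3"] by linarith
    have "a\<^sup>2 + b\<^sup>2 = (w$3)\<^sup>2 * m / (m * m)"
      unfolding a_def b_def by (simp add: m_def power_divide power_mult_distrib power2_eq_square add_divide_distrib[symmetric] distrib_left)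
    then have ab: "a\<^sup>2 + b\<^sup>2 < 1" using m m0 by simp
    have "a * w$1 + b * w$2 = w$3 * m / m"
      unfolding a_def b_def by (simp add: m_def power2_eq_square add_divide_distrib[symmetric] algebra_simps)
    then have w3: "w$3 = a * w$1 + b * w$2" using m0 by simp
    have "x \<in> S \<longleftrightarrow> lorentz w w = (A 0 0 + k * a) * w$1 + (B 0 0 + k * b) * w$2"
      using AB[OF ab, of x] k[OF ab] w3 by (simp add: w_def)
    also have "(A 0 0 + k * a) * w$1 + (B 0 0 + k * b) * w$2 = 2 * lorentz c w"
      by (simp add: lorentz_def c_def vector_3 w3 algebra_simps)
    finally show "x \<in> S \<longleftrightarrow> lorentz (x - p) (x - p) = 2 * lorentz c (x - p)"
      by (simp add: w_def)
  qed
qed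

section \<open>Tangent plane and causal character of \<open>c\<close>\<close>

text \<open>Differentiate the equation along a curve through \<open>p\<close>: the quadratic term
  has derivative zero there, so only the linear term remains.\<close>

lemma tangent_plane_quadric:
  assumes "w \<in> tangent_plane S p" "open V" "p \<in> V"
    and eq: "\<And>x. x \<in> S \<inter> V \<Longrightarrow> lorentz (x - p) (x - p) = 2 * lorentz c (x - p)"
  shows "lorentz c w = 0"
proof -
  obtain e \<alpha> where e: "e > 0" "\<alpha> ` {-e<..<e} \<subseteq> S" "\<alpha> 0 = p"
    and der: "(\<alpha> has_vector_derivative w) (at 0)"
    using assms(1) by (auto simp: tangent_plane_def)
  have comp: "((\<lambda>t. \<alpha> t $ i) has_real_derivative w $ i) (at 0)" for i
    using bounded_linear.has_vector_derivative[OF bounded_linear_vec_nth der]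
    by (simp add: has_real_derivative_iff_has_vector_derivative)
  define g where "g = (\<lambda>t. lorentz (\<alpha> t - p) (\<alpha> t - p) - 2 * lorentz c (\<alpha> t - p))"
  have "(g has_real_derivative - 2 * lorentz c w) (at 0)"
    unfolding g_def lorentz_def
    by (auto intro!: derivative_eq_intros comp simp: e(3) algebra_simps)
  moreover have "\<forall>\<^sub>F t in at 0. g t = 0"
  proof -
    have "isCont \<alpha> 0" using der has_vector_derivative_continuous by blast
    then have "\<forall>\<^sub>F t in at 0. \<alpha> t \<in> V"
      using assms(2,3) e(3) by (metis continuous_at topological_tendstoD isCont_def)
    moreover have "\<forall>\<^sub>F t in at 0. t \<in> {-e<..<e}"
      using e(1) by (intro eventually_at_in_open') auto
    ultimately show ?thesis
      by eventually_elim (use eq e(2) in \<open>auto simp: g_def image_subset_iff\<close>)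
  qed
  moreover have "g 0 = 0" by (simp add: g_def e lorentz_def)
  ultimately have "((\<lambda>_. 0) has_real_derivative - 2 * lorentz c w) (at 0)"
    by (auto simp: has_field_derivative_iff elim!: Lim_transform_eventually eventually_mono)
  then have "- 2 * lorentz c w = 0"
    using DERIV_const DERIV_unique by blast
  then show ?thesis by simp
qed

text \<open>By dimension the tangent plane is the whole orthogonal complement of \<open>c\<close>.
  For nonzero \<open>c\<close> that is not timelike, this complement contains a nonzero vector that
  is not spacelike.\<close>

lemma spacelike_surface_quadric_timelike:
  assumes S: "spacelike_surface S" "p \<in> S" and V: "open V" "p \<in> V"
    and eq: "\<And>x. x \<in> S \<inter> V \<Longrightarrow> lorentz (x - p) (x - p) = 2 * lorentz c (x - p)"
    and pos: "\<And>x. x \<in> S \<inter> V \<Longrightarrow> x \<noteq> p \<Longrightarrow> lorentz (x - p) (x - p) > 0"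
  shows "lorentz c c < 0"
proof (rule ccontr)
  assume "\<not> lorentz c c < 0"
  then have nt: "(c$3)\<^sup>2 \<le> (c$1)\<^sup>2 + (c$2)\<^sup>2"
    by (simp add: lorentz_def power2_eq_square)
  obtain U V' \<phi> where pV: "p \<in> V'" and lp: "local_parametrization S U V' \<phi>"
    using S unfolding spacelike_surface_def regular_surface_def by blast
  then obtain \<psi> where hom: "homeomorphism U (V' \<inter> S) \<phi> \<psi>"
    by (auto simp: local_parametrization_def)
  define q where "q = \<psi> p"
  have q: "q \<in> U" "\<phi> q = p"
    using hom pV S by (auto simp: homeomorphism_def q_def)
  define L where "L = frechet_derivative \<phi> (at q)"
  have lin: "linear L"
    using local_parametrization_derivative[OF lp q(1)] has_derivative_linear by (auto simp: L_def)
  have inj: "inj L" using lp q by (auto simp: local_parametrization_def L_def)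
  have tan: "L h \<in> tangent_plane S p" for h
    using derivative_in_tangent_plane[OF lp q(1)] q L_def by simp
  \<comment> \<open>If \<open>c = 0\<close>, then \<open>p\<close> is isolated in \<open>S\<close>,
    so the quadric equation holds near \<open>p\<close> with any \<open>w\<close> in place of
    \<open>c\<close>. Tangent vectors would be orthogonal to everything, against injectivity of
    \<open>L\<close>.\<close>
  have "c \<noteq> 0"
  proof
    assume "c = 0"
    then have iso: "x = p" if "x \<in> S \<inter> V" for x
      using eq[OF that] pos[OF that] by (auto simp: lorentz_def)
    have "lorentz w (L 1) = 0" for w
      using iso tangent_plane_quadric[OF tan V, where c = w] by (force simp: lorentz_def)
    from this[of "axis 1 1"] this[of "axis 2 1"] this[of "axis 3 1"]
    have "L 1 = 0" by (simp add: lorentz_def axis_def vec3_eq_iff)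
    then show False using inj lin by (metis injD linear_0 zero_neq_one)
  qed
  \<comment> \<open>Lorentz orthogonality to \<open>c\<close> is Euclidean orthogonality to
    \<open>n\<close>, so the dimension formula for hyperplanes applies.\<close>
  define n :: "real^3" where "n = vector [c$1, c$2, - c$3]"
  have n_inner: "n \<bullet> x = lorentz c x" for x
    by (simp add: n_def inner_vec_def sum_3 vector_3 lorentz_def)
  have "n \<noteq> 0" using \<open>c \<noteq> 0\<close> by (auto simp: n_def vec3_eq_iff vector_3)
  have "range L = {x. n \<bullet> x = 0}"
  proof (rule subspace_dim_equal)
    show "subspace (range L)" using lin linear_subspace_image subspace_UNIV by blast
    show "subspace {x. n \<bullet> x = 0}" by (rule subspace_hyperplane)
    show "range L \<subseteq> {x. n \<bullet> x = 0}"
      using tangent_plane_quadric[OF tan V eq] by (auto simp: n_inner)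
    show "dim {x. n \<bullet> x = 0} \<le> dim (range L)"
      using \<open>n \<noteq> 0\<close> inj lin by (simp add: dim_hyperplane dim_image_eq)
  qed
  \<comment> \<open>The steepest direction in the plane orthogonal to \<open>c\<close>, the first
    place to look for failure of spacelikeness.\<close>
  moreover define w :: "real^3" where "w = vector [c$1 * c$3, c$2 * c$3, (c$1)\<^sup>2 + (c$2)\<^sup>2]"
  have "lorentz c w = 0"
    by (simp add: w_def lorentz_def vector_3 power2_eq_square algebra_simps)
  ultimately have "w \<in> tangent_plane S p"
    using tan n_inner by (metis (mono_tags) mem_Collect_eq rangeE)
  moreover have m0: "(c$1)\<^sup>2 + (c$2)\<^sup>2 > 0"
  proof (rule ccontr)
    assume "\<not> ?thesis"
    then have "c$1 = 0" "c$2 = 0" by (auto simp: sum_power2_gt_zero_iff)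
    with nt \<open>c \<noteq> 0\<close> show False by (simp add: vec3_eq_iff)
  qed
  then have "w \<noteq> 0" by (auto simp: w_def vec3_eq_iff vector_3)
  ultimately have "lorentz w w > 0"
    using S unfolding spacelike_surface_def spacelike_subspace_def by blast
  moreover have "lorentz w w = ((c$1)\<^sup>2 + (c$2)\<^sup>2) * ((c$3)\<^sup>2 - ((c$1)\<^sup>2 + (c$2)\<^sup>2))"
    by (simp add: w_def lorentz_def vector_3 power2_eq_square algebra_simps)
  ultimately show False using m0 nt by (simp add: zero_less_mult_iff)
qed

section \<open>The sheets of a hyperboloid\<close>

text \<open>A reversed Cauchy-Schwarz inequality: the sign is that of
  \<open>x$3 * y$3 - (r\<^sup>2 + d)\<close>, and \<open>id\<close> and \<open>id'\<close> compare
  the squares. On one sheet the product wins unless the points coincide; on opposite sheets it is at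
  most \<open>d\<close>.\<close>

lemma hyperboloid_spacelike_iff:
  assumes r: "r > 0" and x: "lorentz x x = - r\<^sup>2" and y: "lorentz y y = - r\<^sup>2"
  shows "lorentz (x - y) (x - y) > 0 \<longleftrightarrow> x \<noteq> y \<and> x$3 * y$3 > 0"
proof -
  define d where "d = x$1 * y$1 + x$2 * y$2"
  have x3: "(x$3)\<^sup>2 = r\<^sup>2 + (x$1)\<^sup>2 + (x$2)\<^sup>2" and y3: "(y$3)\<^sup>2 = r\<^sup>2 + (y$1)\<^sup>2 + (y$2)\<^sup>2"
    using x y by (auto simp: lorentz_def power2_eq_square)
  have xy: "lorentz (x - y) (x - y) = 2 * (x$3 * y$3 - (r\<^sup>2 + d))"
    using x y by (simp add: lorentz_def d_def algebra_simps)
  have id: "(x$3 * y$3)\<^sup>2 - (r\<^sup>2 + d)\<^sup>2 = r\<^sup>2 * ((x$1 - y$1)\<^sup>2 + (x$2 - y$2)\<^sup>2) + (x$1 * y$2 - x$2 * y$1)\<^sup>2"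
    unfolding power_mult_distrib x3 y3 d_def by (simp add: power2_eq_square algebra_simps)
  have id': "(x$3 * y$3)\<^sup>2 - d\<^sup>2 = r\<^sup>2 * (r\<^sup>2 + (x$1)\<^sup>2 + (x$2)\<^sup>2 + (y$1)\<^sup>2 + (y$2)\<^sup>2) + (x$1 * y$2 - x$2 * y$1)\<^sup>2"
    unfolding power_mult_distrib x3 y3 d_def by (simp add: power2_eq_square algebra_simps)
  have "\<bar>d\<bar> \<le> \<bar>x$3 * y$3\<bar>"
  proof -
    have "d\<^sup>2 \<le> (x$3 * y$3)\<^sup>2" using id' by (smt (verit) mult_nonneg_nonneg zero_le_power2)
    then show ?thesis by (simp add: abs_le_square_iff)
  qed
  then have neg: "lorentz (x - y) (x - y) \<le> 0" if "x$3 * y$3 \<le> 0"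
  proof -
    have "\<bar>d\<bar> \<le> - (x$3 * y$3)"
      using \<open>\<bar>d\<bar> \<le> \<bar>x$3 * y$3\<bar>\<close> abs_of_nonpos[OF that] by simp
    then have "x$3 * y$3 \<le> d" by (simp add: abs_le_iff)
    then have "x$3 * y$3 \<le> r\<^sup>2 + d" by (simp add: add_increasing)
    then show ?thesis by (simp add: xy)
  qed
  have "lorentz (x - y) (x - y) > 0" if ne: "x \<noteq> y" and s: "x$3 * y$3 > 0"
  proof -
    have "x$1 \<noteq> y$1 \<or> x$2 \<noteq> y$2"
    proof (rule ccontr)
      assume "\<not> ?thesis"
      then have "x$1 = y$1" "x$2 = y$2" by auto
      moreover from this have "x$3 = y$3 \<or> x$3 = - y$3"
        using x3 y3 by (metis power2_eq_iff)
      moreover have "x$3 \<noteq> - y$3"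
        using s by (auto simp: not_less)
      ultimately show False using ne by (simp add: vec3_eq_iff)
    qed
    then have "r\<^sup>2 * ((x$1 - y$1)\<^sup>2 + (x$2 - y$2)\<^sup>2) > 0"
      using r by (auto simp: sum_power2_gt_zero_iff)
    then have "(r\<^sup>2 + d)\<^sup>2 < (x$3 * y$3)\<^sup>2"
      using id zero_le_power2[of "x$1 * y$2 - x$2 * y$1"] by linarith
    then have "r\<^sup>2 + d < x$3 * y$3"
      using s power2_less_imp_less by fastforce
    then show ?thesis by (simp add: xy)
  qed
  moreover have "\<not> lorentz (x - y) (x - y) > 0" if "x = y"
    using that by (simp add: lorentz_def)
  ultimately show ?thesis using neg by fastforce
qed

lemma two_sheeted_hyperboloid_third_neq:
  assumes "r > 0" "x \<in> two_sheeted_hyperboloid c r"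
  shows "x$3 \<noteq> c$3"
proof
  assume "x$3 = c$3"
  then have "(x$1 - c$1)\<^sup>2 + (x$2 - c$2)\<^sup>2 = - r\<^sup>2"
    using assms(2) by (simp add: two_sheeted_hyperboloid_def lorentz_def power2_eq_square)
  moreover have "r\<^sup>2 > 0" using assms(1) by simp
  ultimately show False using sum_power2_ge_zero[of "x$1 - c$1" "x$2 - c$2"] by linarith
qed

text \<open>The horizontal plane through the centre misses the hyperboloid, so a connected subset
  stays on one side. Connectedness of the sheet is a hypothesis because in the application the sheet
  has already been identified with the connected surface.\<close>

lemma hyperboloid_sheet_component:
  assumes r: "r > 0" and p: "p \<in> two_sheeted_hyperboloid c r"
    and conn: "connected {x \<in> two_sheeted_hyperboloid c r. (x$3 - c$3) * (p$3 - c$3) > 0}"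
  shows "{x \<in> two_sheeted_hyperboloid c r. (x$3 - c$3) * (p$3 - c$3) > 0}
    \<in> components (two_sheeted_hyperboloid c r)" (is "?H \<in> _")
  unfolding in_components_maximal
proof (intro conjI allI impI)
  have n0: "(x$3 - c$3) * (p$3 - c$3) \<noteq> 0" if "x \<in> two_sheeted_hyperboloid c r" for x
    using two_sheeted_hyperboloid_third_neq[OF r] that p by force
  have pH: "p \<in> ?H"
    using p n0[OF p] zero_le_square[of "p$3 - c$3"] unfolding mem_Collect_eq less_le by metis
  then show "?H \<noteq> {}" by blast
  show "?H \<subseteq> two_sheeted_hyperboloid c r" by auto
  show "connected ?H" by (rule conn)
  fix D assume D: "D \<noteq> {} \<and> ?H \<subseteq> D \<and> D \<subseteq> two_sheeted_hyperboloid c r \<and> connected D"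
  have "open {x :: real^3. (x$3 - c$3) * (p$3 - c$3) > 0}" "open {x :: real^3. (x$3 - c$3) * (p$3 - c$3) < 0}"
    by (intro open_Collect_less continuous_intros)+
  moreover have "D \<subseteq> {x. (x$3 - c$3) * (p$3 - c$3) > 0} \<union> {x. (x$3 - c$3) * (p$3 - c$3) < 0}"
  proof
    fix x assume "x \<in> D"
    with D have "x \<in> two_sheeted_hyperboloid c r" by blast
    from n0[OF this] show "x \<in> {x. (x$3 - c$3) * (p$3 - c$3) > 0} \<union> {x. (x$3 - c$3) * (p$3 - c$3) < 0}"
      unfolding Un_iff mem_Collect_eq neq_iff by blast
  qed
  ultimately have "{x. (x$3 - c$3) * (p$3 - c$3) > 0} \<inter> D = {} \<or> {x. (x$3 - c$3) * (p$3 - c$3) < 0} \<inter> D = {}"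
    using D by (intro connectedD) auto
  with pH D have same_side: "\<not> (x$3 - c$3) * (p$3 - c$3) < 0" if "x \<in> D" for x
    using that by blast
  have "D \<subseteq> ?H"
  proof
    fix x assume "x \<in> D"
    with D have x: "x \<in> two_sheeted_hyperboloid c r" by blast
    from n0[OF x] same_side[OF \<open>x \<in> D\<close>] have "(x$3 - c$3) * (p$3 - c$3) > 0"
      unfolding neq_iff by blast
    with x show "x \<in> ?H" by blast
  qed
  with D show "D = ?H" by blast
qed

section \<open>Identification of the surface with a sheet\<close>

theorem theorem1p2:
  fixes S :: "(real^3) set"
  assumes "spacelike_surface S" and "connected S" and "P_star S"
  shows "hyperbolic_plane S"
proof -
  obtain p where p: "p \<in> S"
    using assms(1) by (auto simp: spacelike_surface_def regular_surface_def)
  obtain V where V: "open V" "p \<in> V" "\<And>x. x \<in> S \<inter> V \<Longrightarrow> x \<noteq> p \<Longrightarrow> lorentz (x - p) (x - p) > 0"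
    using spacelike_surface_locally_spacelike[OF assms(1) p] by blast
  obtain c where c: "\<And>x. lorentz (x - p) (x - p) > 0 \<Longrightarrow>
     x \<in> S \<longleftrightarrow> lorentz (x - p) (x - p) = 2 * lorentz c (x - p)"
    using spacelike_section_equation[OF assms(3) p] by blast
  have "lorentz (x - p) (x - p) = 2 * lorentz c (x - p)" if "x \<in> S \<inter> V" for x
    using c[of x] V(3)[of x] that by (cases "x = p") (auto simp: lorentz_def)
  then have tl: "lorentz c c < 0"
    using spacelike_surface_quadric_timelike[OF assms(1) p V(1,2) _ V(3)] by blast
  define r where "r = sqrt (- lorentz c c)"
  have r: "r > 0" "r\<^sup>2 = - lorentz c c" using tl by (auto simp: r_def)
  \<comment> \<open>Completing the square in the section equation gives centre \<open>p + c\<close>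
    and squared radius \<open>- lorentz c c\<close>.\<close>
  define Q where "Q = two_sheeted_hyperboloid (p + c) r"
  have Q_iff: "x \<in> Q \<longleftrightarrow> lorentz (x - p) (x - p) = 2 * lorentz c (x - p)" for x
    unfolding Q_def two_sheeted_hyperboloid_def r(2) by (auto simp: lorentz_def algebra_simps)
  have pQ: "p \<in> Q" by (simp add: Q_iff lorentz_def)
  define H where "H = {x \<in> Q. (x$3 - (p + c)$3) * (p$3 - (p + c)$3) > 0}"
  have c3: "c$3 \<noteq> 0"
    using two_sheeted_hyperboloid_third_neq[OF r(1) pQ[unfolded Q_def]] by simp
  then have pH: "p \<in> H" using pQ by (auto simp: H_def zero_less_mult_iff neq_iff)
  have sep: "lorentz (x - p) (x - p) > 0 \<longleftrightarrow> x \<in> H" if "x \<in> Q" "x \<noteq> p" for x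
  proof -
    have "lorentz (x - (p + c)) (x - (p + c)) = - r\<^sup>2" "lorentz (p - (p + c)) (p - (p + c)) = - r\<^sup>2"
      using that pQ by (auto simp: Q_def two_sheeted_hyperboloid_def)
    from hyperboloid_spacelike_iff[OF r(1) this] that show ?thesis
      by (simp add: H_def)
  qed
  have H_eq: "H = insert p {x \<in> S. lorentz (x - p) (x - p) > 0}"
  proof (intro set_eqI)
    show "x \<in> H \<longleftrightarrow> x \<in> insert p {x \<in> S. lorentz (x - p) (x - p) > 0}" for x
    proof (cases "x = p")
      case False
      have "x \<in> Q" if "x \<in> H" using that by (simp add: H_def)
      with False sep[of x] c[of x] Q_iff[of x] show ?thesis by blast
    qed (simp add: pH)
  qed
  \<comment> \<open>The set \<open>V\<close> adds only \<open>p\<close>, since the other points of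
    \<open>S\<close> in \<open>V\<close> are spacelike separated from \<open>p\<close>; it makes
    \<open>H\<close> relatively open at \<open>p\<close>.\<close>
  have "H = S \<inter> (V \<union> {x. lorentz (x - p) (x - p) > 0})"
    using H_eq V p by auto
  then have "openin (top_of_set S) H"
    using openin_open_Int[OF open_Un[OF V(1) open_spacelike[of p]], of S] by simp
  moreover have "closedin (top_of_set S) H"
  proof -
    \<comment> \<open>The product never vanishes on \<open>Q\<close>, so the strict inequality may
      be weakened to a closed condition.\<close>
    have "H = {x \<in> Q. (x$3 - (p + c)$3) * (p$3 - (p + c)$3) \<ge> 0}"
      unfolding H_def
    proof (intro Collect_cong conj_cong refl)
      fix x assume "x \<in> Q"
      then have "x$3 - (p + c)$3 \<noteq> 0" "p$3 - (p + c)$3 \<noteq> 0"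
        using two_sheeted_hyperboloid_third_neq[OF r(1), of _ "p + c"] c3 unfolding Q_def by auto
      then show "(x$3 - (p + c)$3) * (p$3 - (p + c)$3) > 0 \<longleftrightarrow> (x$3 - (p + c)$3) * (p$3 - (p + c)$3) \<ge> 0"
        by (metis less_le no_zero_divisors)
    qed
    moreover have "closed {x. lorentz (x - p) (x - p) = 2 * lorentz c (x - p)}"
      by (intro closed_Collect_eq continuous_intros)
    moreover have "closed {x :: real^3. (x$3 - (p + c)$3) * (p$3 - (p + c)$3) \<ge> 0}"
      by (intro closed_Collect_le continuous_intros)
    ultimately have "closed H"
      by (simp add: Q_iff Collect_conj_eq closed_Int)
    then show ?thesis using H_eq p by (auto intro!: closed_subset)
  qed
  ultimately have "H = S"
    using assms(2) pH unfolding connected_clopen by blast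
  then have "S \<in> components Q"
    using hyperboloid_sheet_component[OF r(1) pQ[unfolded Q_def]] assms(2)
    by (simp add: H_def Q_def)
  then show ?thesis
    using r(1) unfolding hyperbolic_plane_def Q_def by blast
qed

end
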